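(* Let $D$ be a reduced knot diagram. A perfect matching $x\in\widetilde{X}(D)$ is admissible if and only if $|J(x)|$ is odd.
   Context: Setting. $D$ is (the projection of) a knot diagram with at least one crossing, viewed as a connected 4-valent graph on $S^2$, with a chequerboard black/white colouring of the regions. $D$ is reduced if it has no nugatory crossing, i.e. no crossing has the same region at two of its four corners. The overlaid Tait graph $\Gamma(D)$ is the plane graph whose vertices are the black regions, the white regions and the crossings, with an edge joining each crossing to the region at each of its four corners. $\widetilde X(D)$ is the set of partial Kauffman states: injections from a subset of the crossings to the set of regions, pairing each crossing in the subset with one of its four adjacent regions; equivalently, matchings on $\Gamma(D)$. A matching is perfect here if every crossing is matched (so exactly two regions are unmatched); a perfect matching is admissible if exactly one black and one white region are unmatched. The Jordan resolution $J(x)$ is the curve on $S^2$ obtained from $D$ by resolving (smoothing) each crossing matched by $x$ so that the region it is matched with gets joined, at that crossing, to the opposite region of the same colour. $|J(x)|$ is its number of connected components. *)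

theory Defs
  imports Main "HOL-Combinatorics.Orbits"
begin

text \<open>
  A 4-valent graph on the oriented sphere is encoded, up to orientation-preserving homeomorphism,
  as a combinatorial map on its half-edges (darts).  Every half-edge points away from the crossing
  it is attached to; \<open>rot\<close> is the next half-edge counterclockwise at the same crossing and \<open>flip\<close>
  is the other half of the same edge.  Loops and multiple edges are allowed.  Over/under
  information is not recorded: only the projection matters.
\<close>

record 'h projection =
  half_edges :: "'h set"
  rot :: "'h \<Rightarrow> 'h"
  flip :: "'h \<Rightarrow> 'h"

definition crossing :: "'h projection \<Rightarrow> 'h \<Rightarrow> 'h set" where
  "crossing D h = orbit (rot D) h"

definition crossings :: "'h projection \<Rightarrow> 'h set set" where
  "crossings D = crossing D ` half_edges D"

definition edges :: "'h projection \<Rightarrow> 'h set set" where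
  "edges D = (\<lambda>h. {h, flip D h}) ` half_edges D"

text \<open>
  A half-edge \<open>h\<close> also names a corner, namely the one between \<open>h\<close> and its clockwise neighbour, so
  to the right of \<open>h\<close>.  Hence the elements of a crossing are also its four corners, in
  counterclockwise order \<open>h\<close>, \<open>rot h\<close>, \<open>rot (rot h)\<close>, \<open>rot (rot (rot h))\<close>.  Walking along \<open>h\<close> with a
  region on the right, the next corner of that region is the one named by \<open>rot (flip h)\<close>; a region
  is thus represented by the set of its corners, an orbit of \<open>rot \<circ> flip\<close>.  The regions on
  the two sides of the edge of \<open>h\<close> are those of \<open>h\<close> and \<open>flip h\<close>.
\<close>

definition region :: "'h projection \<Rightarrow> 'h \<Rightarrow> 'h set" where
  "region D h = orbit (rot D \<circ> flip D) h"

definition regions :: "'h projection \<Rightarrow> 'h set set" where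
  "regions D = region D ` half_edges D"

text \<open>The last clause of the next definition is Euler's formula: for a connected combinatorial map
  it says that the underlying closed oriented surface is the sphere.\<close>

definition connected_four_valent_sphere_graph :: "'h projection \<Rightarrow> bool" where
  "connected_four_valent_sphere_graph D \<longleftrightarrow>
     finite (half_edges D) \<and> half_edges D \<noteq> {} \<and>
     rot D permutes half_edges D \<and> flip D permutes half_edges D \<and>
     (\<forall>h\<in>half_edges D. flip D h \<noteq> h \<and> flip D (flip D h) = h) \<and>
     (\<forall>c\<in>crossings D. card c = 4) \<and>
     (\<forall>h\<in>half_edges D. \<forall>k\<in>half_edges D.
        (h, k) \<in> ({(a, rot D a) | a. a \<in> half_edges D} \<union> {(a, flip D a) | a. a \<in> half_edges D})\<^sup>*) \<and>
     int (card (crossings D)) - int (card (edges D)) + int (card (regions D)) = 2"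

text \<open>The link components of the diagram are traced by going along edges and straight through
  crossings (from a half-edge to the opposite one); a knot has just one.\<close>

definition knot_projection :: "'h projection \<Rightarrow> bool" where
  "knot_projection D \<longleftrightarrow>
     connected_four_valent_sphere_graph D \<and>
     (\<forall>h\<in>half_edges D. \<forall>k\<in>half_edges D.
        (h, k) \<in> ({(a, rot D (rot D a)) | a. a \<in> half_edges D} \<union>
                  {(a, flip D a) | a. a \<in> half_edges D})\<^sup>*)"

definition reduced :: "'h projection \<Rightarrow> bool" where
  "reduced D \<longleftrightarrow> (\<forall>c\<in>crossings D. inj_on (region D) c)"

text \<open>A colouring is given by its set of black regions; the other regions are white.\<close>

definition chequerboard_colouring :: "'h projection \<Rightarrow> 'h set set \<Rightarrow> bool" where
  "chequerboard_colouring D black \<longleftrightarrow>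
     black \<subseteq> regions D \<and>
     (\<forall>h\<in>half_edges D. region D h \<in> black \<longleftrightarrow> region D (flip D h) \<notin> black)"

type_synonym 'h matching = "'h set \<rightharpoonup> 'h set"

definition partial_Kauffman_states :: "'h projection \<Rightarrow> 'h matching set" where
  "partial_Kauffman_states D =
     {x. dom x \<subseteq> crossings D \<and> inj_on x (dom x) \<and>
         (\<forall>c r. x c = Some r \<longrightarrow> r \<in> region D ` c)}"

definition perfect :: "'h projection \<Rightarrow> 'h matching \<Rightarrow> bool" where
  "perfect D x \<longleftrightarrow> dom x = crossings D"

definition unmatched_regions :: "'h projection \<Rightarrow> 'h matching \<Rightarrow> 'h set set" where
  "unmatched_regions D x = regions D - ran x"

definition admissible :: "'h projection \<Rightarrow> 'h set set \<Rightarrow> 'h matching \<Rightarrow> bool" where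
  "admissible D black x \<longleftrightarrow>
     perfect D x \<and>
     card (unmatched_regions D x \<inter> black) = 1 \<and>
     card (unmatched_regions D x - black) = 1"

text \<open>
  The Jordan resolution, as a graph on the half-edges of \<open>D\<close>: two half-edges are linked if they
  form an edge of \<open>D\<close> or if they are joined by an arc at a crossing.  If a crossing is matched with
  the region at its corner \<open>h\<close>, the corners \<open>h\<close> and \<open>rot (rot h)\<close> get joined, so the arcs of
  the smoothing cut off the other two corners: one arc connects \<open>h\<close> to \<open>rot h\<close>, the other connects
  \<open>rot (rot h)\<close> to \<open>rot (rot (rot h))\<close>.  At an unmatched crossing all four half-edges stay
  connected.
\<close>

inductive_set Jordan_resolution :: "'h projection \<Rightarrow> 'h matching \<Rightarrow> ('h \<times> 'h) set"
  for D :: "'h projection" and x :: "'h matching" where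
  edge: "h \<in> half_edges D \<Longrightarrow> (h, flip D h) \<in> Jordan_resolution D x"
| arc: "h \<in> half_edges D \<Longrightarrow> x (crossing D h) = Some (region D h) \<Longrightarrow>
    (h, rot D h) \<in> Jordan_resolution D x"
| opposite_arc: "h \<in> half_edges D \<Longrightarrow> x (crossing D h) = Some (region D h) \<Longrightarrow>
    (rot D (rot D h), rot D (rot D (rot D h))) \<in> Jordan_resolution D x"
| unresolved: "h \<in> half_edges D \<Longrightarrow> x (crossing D h) = None \<Longrightarrow>
    (h, rot D h) \<in> Jordan_resolution D x"

definition Jordan_components :: "'h projection \<Rightarrow> 'h matching \<Rightarrow> 'h set set" where
  "Jordan_components D x =
     half_edges D // (Jordan_resolution D x \<union> (Jordan_resolution D x)\<inverse>)\<^sup>*"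

end

theory Submission
  imports Defs
begin

text \<open>
  The chequerboard colouring turns \<open>rot \<circ> flip\<close> into a permutation \<open>\<sigma>\<close> of the black corners whose
  cycles are the black regions.  Let \<open>\<tau>\<close> exchange the two black corners of every crossing that is
  matched with a black region.  Then the cycles of \<open>\<tau> \<circ> \<sigma>\<close> correspond to the components of the Jordan
  resolution.  The sign of a permutation determines the parity of its number of cycles, and \<open>\<tau>\<close> is a
  product of as many transpositions as there are crossings matched with a black region, so the number
  of components has the parity of the number of unmatched black regions.  By Euler's formula exactly
  two regions are unmatched, hence that number is odd iff it is 1 iff the matching is admissible.
\<close>

section \<open>Cycles and signs of permutations\<close>

text \<open>Equal fibres make \<open>f a\<close> and \<open>g a\<close> determine each other, so it
  does not matter which preimage \<open>SOME\<close> picks in \<open>?h\<close>. This compares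
  numbers of classes without naming representatives.\<close>

lemma card_image_eq_of_same_fibres:
  assumes "\<And>a b. a \<in> A \<Longrightarrow> b \<in> A \<Longrightarrow> f a = f b \<longleftrightarrow> g a = g b"
  shows "card (f ` A) = card (g ` A)"
proof (rule bij_betw_same_card)
  let ?h = "\<lambda>y. g (SOME a. a \<in> A \<and> f a = y)"
  have h: "?h (f a) = g a" if "a \<in> A" for a
  proof -
    have "(SOME b. b \<in> A \<and> f b = f a) \<in> A \<and> f (SOME b. b \<in> A \<and> f b = f a) = f a"
      by (rule someI[of _ a]) (use that in simp)
    then show ?thesis
      using assms that by blast
  qed
  have "inj_on ?h (f ` A)"
    by (rule inj_onI) (use h assms in auto)
  moreover have "?h ` f ` A = g ` A"
    unfolding image_image by (rule image_cong) (use h in auto)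
  ultimately show "bij_betw ?h (f ` A) (g ` A)"
    by (simp add: bij_betw_def)
qed

lemma orbit_eq_iff:
  assumes "permutation p"
  shows "orbit p a = orbit p b \<longleftrightarrow> b \<in> orbit p a"
  using permutation_self_in_orbit[OF assms] orbit_cyclic_eq3[OF cyclic_on_orbit'[OF assms]]
  by metis

text \<open>The size of a cycle is the first return time \<open>funpow_dist1\<close>. This turns
  four half-edges per crossing into a fourth power equal to the identity.\<close>

lemma funpow_card_orbit:
  assumes "a \<in> orbit f a"
  shows "(f ^^ card (orbit f a)) a = a"
proof -
  have "card (orbit f a) = funpow_dist1 f a a"
    by (subst orbit_conv_funpow_dist1[OF assms])
      (simp add: card_image[OF inj_on_funpow_dist1[OF assms]])
  then show ?thesis
    using funpow_dist1_prop[OF assms] by simp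
qed

lemma disjoint_orbits:
  assumes "permutation p" "orbit p a \<noteq> orbit p b"
  shows "orbit p a \<inter> orbit p b = {}"
  using assms by (metis disjoint_iff orbit_eq_iff)

lemma Union_orbits:
  assumes "p permutes S" "finite S"
  shows "\<Union> (orbit p ` S) = S"
proof -
  have "permutation p"
    using assms permutation_permutes by blast
  then show ?thesis
    using permutes_orbit_subset[OF assms(1)] permutation_self_in_orbit by fastforce
qed

lemma card_orbits_uniform:
  assumes "p permutes S" "finite S" "\<And>a. a \<in> S \<Longrightarrow> card (orbit p a) = k"
  shows "card S = k * card (orbit p ` S)"
proof -
  have p: "permutation p"
    using assms permutation_permutes by blast
  have "k * card (orbit p ` S) = card (\<Union> (orbit p ` S))"
  proof (rule card_partition)
    show "c \<inter> d = {}" if "c \<in> orbit p ` S" "d \<in> orbit p ` S" "c \<noteq> d" for c d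
      using that disjoint_orbits[OF p] by blast
  qed (use assms Union_orbits[OF assms(1,2)] in auto)
  then show ?thesis
    by (simp add: Union_orbits[OF assms(1,2)])
qed

text \<open>The map \<open>q\<close> fixes \<open>a\<close> and sends the \<open>p\<close>-preimage
  of \<open>a\<close> straight to \<open>p a\<close>; elsewhere it agrees with \<open>p\<close>. So
  \<open>a\<close> is cut out of its cycle and all else stays.\<close>

lemma orbit_shortcut:
  fixes p :: "'a \<Rightarrow> 'a"
  assumes p: "p permutes S" "finite S" and a: "p a \<noteq> a" "a \<in> S" and b: "b \<noteq> a"
  defines "q \<equiv> transpose a (p a) \<circ> p"
  shows "orbit q b = orbit p b - {a}"
proof -
  have inj: "p y = p z \<longleftrightarrow> y = z" for y z
    using permutes_inj[OF p(1)] by (simp add: inj_eq)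
  have q: "q y = (if p y = a then p a else p y)" if "y \<noteq> a" for y
    using that inj by (auto simp: q_def transpose_def)
  have 1: "z \<in> orbit p b \<and> z \<noteq> a" if "z \<in> orbit q b" for z
    using that
  proof induction
    case base
    then show ?case
      using q[OF b] a orbit.base[of p b] orbit.step[of a p b] by (auto split: if_splits)
  next
    case (step z)
    then show ?case
      using q[of z] a orbit.step[of z p b] orbit.step[of a p b] by (auto split: if_splits)
  qed
  \<comment> \<open>When the \<open>p\<close>-path sits at \<open>a\<close>, which \<open>q\<close>
    skips, the invariant speaks of the next point \<open>p a\<close> instead.\<close>
  have 2: "(z \<noteq> a \<longrightarrow> z \<in> orbit q b) \<and> (z = a \<longrightarrow> p z \<in> orbit q b)" if "z \<in> orbit p b" for z
    using that
  proof induction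
    case base
    then show ?case
      using q[OF b] orbit.base[of q b] by (auto split: if_splits)
  next
    case (step z)
    then show ?case
      using q[of z] a orbit.step[of z q b] by (cases "z = a") (auto split: if_splits)
  qed
  show ?thesis
    using 1 2 by blast
qed

text \<open>Induction on the support: bypassing a moved point changes the sign and removes one point, but
  keeps the number of cycles.\<close>

lemma evenperm_iff_card_orbits:
  assumes "finite S" "p permutes S"
  shows "evenperm p \<longleftrightarrow> even (card S + card (orbit p ` S))"
  using assms
proof (induction S arbitrary: p rule: finite_induct)
  case empty
  then have "p = id"
    using permutes_empty by blast
  then show ?case
    by simp
next
  case (insert a S)
  have fin: "finite (insert a S)"
    using insert by simp
  have perm: "permutation p"
    using insert.prems fin permutation_permutes by blast
  show ?case
  proof (cases "p a = a")
    case True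
    \<comment> \<open>A fixed point adds one point and one cycle, which leaves the parity unchanged,
      as it leaves the sign.\<close>
    have pS: "p permutes S"
      using insert.prems by (rule permutes_superset) (use True in auto)
    have "orbit p a = {a}"
      using True orbit_eq_singleton_iff by metis
    moreover have "orbit p a \<notin> orbit p ` S"
    proof
      assume "orbit p a \<in> orbit p ` S"
      then obtain b where "b \<in> S" "orbit p b = {a}"
        using \<open>orbit p a = {a}\<close> by auto
      then show False
        using permutes_orbit_subset[OF pS] insert.hyps by blast
    qed
    ultimately show ?thesis
      using insert.IH[OF pS] insert.hyps by simp
  next
    case False
    define q where "q = transpose a (p a) \<circ> p"
    have pa: "p a \<in> S"
      using insert.prems False permutes_in_image[of p "insert a S" a] by auto
    have "q permutes insert a S"
      unfolding q_def
      by (rule permutes_compose[OF insert.prems permutes_swap_id]) (use pa in auto)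
    then have qS: "q permutes S"
      by (rule permutes_superset) (auto simp: q_def)
    have "evenperm q \<longleftrightarrow> \<not> evenperm p"
      unfolding q_def
      by (subst evenperm_comp) (use perm False in \<open>auto simp: evenperm_swap permutation_swap_id\<close>)
    moreover have "card (orbit q ` S) = card (orbit p ` insert a S)"
    proof -
      \<comment> \<open>The cycle of \<open>a\<close> also passes through \<open>p a\<close> in
        \<open>S\<close>, so no cycle is lost by dropping \<open>a\<close>.\<close>
      have "orbit p a = orbit p (p a)"
        using permutation_orbit_step[OF perm] by metis
      then have img: "orbit p ` insert a S = orbit p ` S"
        using pa by auto
      have "orbit q b = orbit p b - {a}" if "b \<in> S" for b
        unfolding q_def
        by (rule orbit_shortcut[OF insert.prems fin False]) (use that insert.hyps in auto)
      moreover have "b \<in> orbit p b" for b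
        using permutation_self_in_orbit[OF perm] .
      ultimately have "orbit q b = orbit q c \<longleftrightarrow> orbit p b = orbit p c" if "b \<in> S" "c \<in> S" for b c
        using that insert.hyps orbit_eq_iff[OF perm] by (metis Diff_iff singletonD)
      then have "card (orbit q ` S) = card (orbit p ` S)"
        by (rule card_image_eq_of_same_fibres)
      then show ?thesis
        using img by simp
    qed
    ultimately show ?thesis
      using insert.IH[OF qS] insert.hyps by simp
  qed
qed

section \<open>Coloured projections\<close>

locale coloured_projection =
  fixes D :: "'h projection" and black :: "'h set set"
  assumes sphere_graph: "connected_four_valent_sphere_graph D"
    and colouring: "chequerboard_colouring D black"
begin

abbreviation "H \<equiv> half_edges D"
abbreviation "r \<equiv> rot D"
abbreviation "f \<equiv> flip D"

abbreviation dark :: "'h \<Rightarrow> bool" where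
  "dark h \<equiv> region D h \<in> black"

definition dark_corners :: "'h set" where
  "dark_corners = {h \<in> H. dark h}"

section \<open>Half-edges at a crossing and the colours of its corners\<close>

lemma finite_H: "finite H"
  and r_permutes: "r permutes H"
  and f_permutes: "f permutes H"
  and f_neq: "h \<in> H \<Longrightarrow> f h \<noteq> h"
  and f_f: "h \<in> H \<Longrightarrow> f (f h) = h"
  and card_crossing: "h \<in> H \<Longrightarrow> card (crossing D h) = 4"
  and Euler: "int (card (crossings D)) - int (card (edges D)) + int (card (regions D)) = 2"
  using sphere_graph by (auto simp: connected_four_valent_sphere_graph_def crossings_def)

lemma r_in: "h \<in> H \<Longrightarrow> r h \<in> H"
  and f_in: "h \<in> H \<Longrightarrow> f h \<in> H"
  using permutes_in_image[OF r_permutes] permutes_in_image[OF f_permutes] by auto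

lemma rf_permutes: "r \<circ> f permutes H"
  by (rule permutes_compose[OF f_permutes r_permutes])

lemma permutation_r: "permutation r" and permutation_rf: "permutation (r \<circ> f)"
  using finite_H r_permutes rf_permutes permutation_permutes by blast+

lemma r4: "h \<in> H \<Longrightarrow> r (r (r (r h))) = h"
  using funpow_card_orbit[OF permutation_self_in_orbit[OF permutation_r], of h] card_crossing[of h]
  by (simp add: crossing_def numeral_eq_Suc)

lemma crossing_eq:
  assumes "h \<in> H"
  shows "crossing D h = {h, r h, r (r h), r (r (r h))}"
proof
  show "crossing D h \<subseteq> {h, r h, r (r h), r (r (r h))}"
  proof
    fix k assume "k \<in> crossing D h"
    then have "k \<in> orbit r h" by (simp add: crossing_def)
    then show "k \<in> {h, r h, r (r h), r (r (r h))}"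
      by induction (use r4[OF assms] in auto)
  qed
  show "{h, r h, r (r h), r (r (r h))} \<subseteq> crossing D h"
    using permutation_self_in_orbit[OF permutation_r, of h]
    by (auto simp: crossing_def intro: orbit.intros)
qed

lemma crossing_r: "crossing D (r h) = crossing D h"
  by (simp add: crossing_def permutation_orbit_step[OF permutation_r])

lemma crossing_subset: "h \<in> H \<Longrightarrow> crossing D h \<subseteq> H"
  by (auto simp: crossing_eq r_in)

lemma in_crossing_iff: "crossing D h = crossing D k \<longleftrightarrow> k \<in> crossing D h"
  by (simp add: crossing_def orbit_eq_iff[OF permutation_r])

lemma in_crossings: "h \<in> H \<Longrightarrow> crossing D h \<in> crossings D"
  by (simp add: crossings_def)

lemma r_r_neq: "h \<in> H \<Longrightarrow> r (r h) \<noteq> h"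
proof
  assume h: "h \<in> H" and "r (r h) = h"
  then have "crossing D h = {h, r h}"
    by (auto simp: crossing_eq)
  then have "card (crossing D h) \<le> 2"
    by (simp add: card_insert_if)
  then show False
    using card_crossing[OF h] by simp
qed

lemma dark_f: "h \<in> H \<Longrightarrow> dark (f h) \<longleftrightarrow> \<not> dark h"
  using colouring by (auto simp: chequerboard_colouring_def)

lemma region_rf: "region D (r (f h)) = region D h"
  using permutation_orbit_step[OF permutation_rf, of h] by (simp add: region_def)

text \<open>By \<open>region_rf\<close> at \<open>f h\<close>, the corner \<open>r h\<close> lies in
  the region of \<open>f h\<close>, across the edge of \<open>h\<close>. Hence colours alternate
  around a crossing.\<close>

lemma dark_r: "h \<in> H \<Longrightarrow> dark (r h) \<longleftrightarrow> \<not> dark h"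
  using region_rf[of "f h"] by (simp add: f_f dark_f)

section \<open>The number of regions, and black regions as cycles\<close>

lemma dark_corners_iff: "h \<in> dark_corners \<longleftrightarrow> h \<in> H \<and> dark h"
  by (simp add: dark_corners_def)

lemma finite_dark_corners: "finite dark_corners"
  by (simp add: dark_corners_def finite_H)

lemma finite_regions: "finite (regions D)"
  by (simp add: regions_def finite_H)

lemma black_subset: "black \<subseteq> regions D"
  using colouring by (simp add: chequerboard_colouring_def)

lemma black_eq: "black = region D ` dark_corners"
  using black_subset by (auto simp: regions_def dark_corners_def)

text \<open>Four half-edges per crossing and two per edge give twice as many edges as crossings;
  Euler's formula does the rest.\<close>

lemma card_regions: "card (regions D) = card (crossings D) + 2"
proof -
  have "card H = 4 * card (crossings D)"
    unfolding crossings_def crossing_def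
    by (rule card_orbits_uniform[OF r_permutes finite_H])
      (use card_crossing in \<open>simp add: crossing_def\<close>)
  moreover have "card H = 2 * card (edges D)"
  proof -
    have "orbit f h = {h, f h}" if "h \<in> H" for h
    proof -
      have "k \<in> {h, f h}" if "k \<in> orbit f h" for k
        using that by induction (use f_f[OF \<open>h \<in> H\<close>] in auto)
      then show ?thesis
        using orbit.base[of f h] orbit.step[of "f h" f h] f_f[OF that] by auto
    qed
    then have "edges D = orbit f ` H" and "card (orbit f h) = 2" if "h \<in> H" for h
      using that f_neq[of h] by (auto simp: edges_def)
    \<comment> \<open>Both facts above were obtained for a given element of \<open>H\<close>, hence
      the case split on \<open>H\<close> being empty.\<close>
    then show ?thesis
      using card_orbits_uniform[OF f_permutes finite_H, of 2]
      by (cases "H = {}") (auto simp: edges_def)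
  qed
  ultimately show ?thesis
    using Euler by linarith
qed

definition sigma :: "'h \<Rightarrow> 'h" where
  "sigma = restrict_id (r \<circ> f) dark_corners"

text \<open>Passing to the next corner stays in the same region and so keeps the colour; an
  injective self-map of a finite set is onto.\<close>

lemma sigma_permutes: "sigma permutes dark_corners"
  unfolding sigma_def
proof (rule permutes_restrict_id)
  have "inj_on (r \<circ> f) dark_corners"
    using permutes_inj_on[OF rf_permutes] .
  moreover have "(r \<circ> f) ` dark_corners \<subseteq> dark_corners"
    by (auto simp: dark_corners_iff r_in f_in region_rf)
  ultimately show "bij_betw (r \<circ> f) dark_corners dark_corners"
    by (intro bij_betw_imageI endo_inj_surj finite_dark_corners)
qed

lemma orbits_sigma: "orbit sigma ` dark_corners = black"
proof -
  have "orbit sigma h = region D h" if "h \<in> dark_corners" for h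
    unfolding region_def
    by (rule orbit_cong0[OF that])
      (use permutes_in_image[OF sigma_permutes] in \<open>auto simp: sigma_def\<close>)
  then have "orbit sigma ` dark_corners = region D ` dark_corners"
    by (rule image_cong[OF refl])
  then show ?thesis
    by (rule trans[OF _ black_eq[symmetric]])
qed

end

section \<open>The Jordan resolution of a perfect matching\<close>

locale perfect_matching = coloured_projection D black
  for D :: "'h projection" and black +
  fixes x :: "'h matching"
  assumes state: "x \<in> partial_Kauffman_states D"
    and perfect: "perfect D x"
begin

text \<open>At every crossing \<open>c\<close> the value \<open>x c\<close> is defined by
  \<open>dom_x\<close>, so \<open>the\<close> never meets \<open>None\<close> there.\<close>

definition to_black :: "'h set \<Rightarrow> bool" where
  "to_black c \<longleftrightarrow> the (x c) \<in> black"

lemma dom_x: "dom x = crossings D"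
  using perfect by (simp add: perfect_def)

lemma inj_x: "inj_on x (crossings D)"
  using state dom_x by (simp add: partial_Kauffman_states_def)

lemma matched_corner:
  assumes "h \<in> H"
  obtains k where "k \<in> crossing D h" "x (crossing D h) = Some (region D k)"
proof -
  have "crossing D h \<in> dom x"
    using assms dom_x in_crossings by simp
  then obtain q where "x (crossing D h) = Some q"
    by blast
  moreover from this have "q \<in> region D ` crossing D h"
    using state by (simp add: partial_Kauffman_states_def)
  ultimately show ?thesis
    using that by blast
qed

section \<open>Smoothings read off from colours\<close>

lemma opposite_dark: "h \<in> H \<Longrightarrow> dark (r (r h)) \<longleftrightarrow> dark h"
  by (simp add: dark_r r_in)

text \<open>Among the four corners only the opposite one shares the colour of \<open>h\<close>. A
  match at a neighbouring corner goes to a region of the other colour, which differs from both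
  regions on this diagonal. Thus colour alone decides the smoothing.\<close>

lemma same_colour_iff_matched_diagonal:
  assumes "h \<in> H"
  shows "(dark h \<longleftrightarrow> to_black (crossing D h)) \<longleftrightarrow>
    x (crossing D h) = Some (region D h) \<or> x (crossing D h) = Some (region D (r (r h)))"
proof -
  obtain k where k: "k \<in> crossing D h" "x (crossing D h) = Some (region D k)"
    using matched_corner[OF assms] .
  have to_black: "to_black (crossing D h) \<longleftrightarrow> dark k"
    by (simp add: to_black_def k)
  have "k \<in> {h, r h, r (r h), r (r (r h))}"
    using k(1) crossing_eq[OF assms] by simp
  then consider "k = h \<or> k = r (r h)" | "dark k \<longleftrightarrow> \<not> dark h"
    using assms dark_r[of h] dark_r[of "r (r h)"] opposite_dark[of h] r_in by blast
  then show ?thesis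
  proof cases
    case 1
    then show ?thesis
      unfolding to_black k(2) using opposite_dark[OF assms] by blast
  next
    case 2
    then have "region D k \<noteq> region D h" "region D k \<noteq> region D (r (r h))"
      using opposite_dark[OF assms] by metis+
    then show ?thesis
      unfolding to_black k(2) using 2 by blast
  qed
qed

text \<open>Both arcs at a crossing start at half-edges naming corners of the matched colour, so one
  colour rule covers them; perfection rules out unresolved crossings.\<close>

lemma Jordan_resolution_iff:
  "(h, k) \<in> Jordan_resolution D x \<longleftrightarrow>
     h \<in> H \<and> (k = f h \<or> k = r h \<and> (dark h \<longleftrightarrow> to_black (crossing D h)))"
proof
  assume "(h, k) \<in> Jordan_resolution D x"
  then show "h \<in> H \<and> (k = f h \<or> k = r h \<and> (dark h \<longleftrightarrow> to_black (crossing D h)))"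
  proof cases
    case (opposite_arc g)
    then show ?thesis
      using same_colour_iff_matched_diagonal[of g]
      by (simp add: r_in opposite_dark crossing_r)
  next
    case unresolved
    then show ?thesis
      using dom_x in_crossings by blast
  qed (use same_colour_iff_matched_diagonal in \<open>simp_all\<close>)
next
  assume *: "h \<in> H \<and> (k = f h \<or> k = r h \<and> (dark h \<longleftrightarrow> to_black (crossing D h)))"
  show "(h, k) \<in> Jordan_resolution D x"
  proof (cases "k = f h")
    case True
    then show ?thesis
      using * Jordan_resolution.edge by metis
  next
    case False
    then have h: "h \<in> H" "k = r h"
      and "x (crossing D h) = Some (region D h) \<or> x (crossing D h) = Some (region D (r (r h)))"
      using * same_colour_iff_matched_diagonal[of h] by auto
    \<comment> \<open>If the match is at \<open>r (r h)\<close>, the arc from \<open>h\<close> is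
      the opposite arc for that corner, since four turns return to \<open>h\<close>.\<close>
    then show ?thesis
      using Jordan_resolution.arc[of h D x] Jordan_resolution.opposite_arc[of "r (r h)" D x]
      by (auto simp: r_in r4 crossing_r)
  qed
qed

section \<open>The tracing permutation and the sign of \<open>tau\<close>\<close>

definition tau :: "'h \<Rightarrow> 'h" where
  "tau = restrict_id (r \<circ> r) {h \<in> dark_corners. to_black (crossing D h)}"

text \<open>One step goes to the next corner of the black region and then, where the smoothing has
  merged two black corners, jumps to the opposite one.\<close>

definition trace :: "'h \<Rightarrow> 'h" where
  "trace = tau \<circ> sigma"

lemma tau_permutes: "tau permutes {h \<in> dark_corners. to_black (crossing D h)}" (is "_ permutes ?T")
  unfolding tau_def
proof (rule permutes_restrict_id)
  have "inj_on (r \<circ> r) ?T"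
    using permutes_inj_on[OF permutes_compose[OF r_permutes r_permutes]] .
  moreover have "(r \<circ> r) ` ?T \<subseteq> ?T"
    by (auto simp: dark_corners_iff r_in opposite_dark crossing_r)
  ultimately show "bij_betw (r \<circ> r) ?T ?T"
    by (intro bij_betw_imageI endo_inj_surj) (simp_all add: finite_dark_corners)
qed

lemma trace_permutes: "trace permutes dark_corners"
  unfolding trace_def
  by (rule permutes_compose[OF sigma_permutes permutes_subset[OF tau_permutes]]) auto

lemma permutation_sigma: "permutation sigma"
  and permutation_tau: "permutation tau"
  and permutation_trace: "permutation trace"
proof -
  have "finite {h \<in> dark_corners. to_black (crossing D h)}"
    using finite_dark_corners by simp
  then show "permutation sigma" "permutation tau" "permutation trace"
    using finite_dark_corners sigma_permutes tau_permutes trace_permutes permutation_permutes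
    by blast+
qed

text \<open>On \<open>?T\<close> all cycles of \<open>tau\<close> have length 2, one for each
  crossing matched with black. With n such cycles the sign is the parity of 2n + n, that is, of
  n.\<close>

lemma evenperm_tau: "evenperm tau \<longleftrightarrow> even (card {c \<in> crossings D. to_black c})"
proof -
  let ?T = "{h \<in> dark_corners. to_black (crossing D h)}"
  have fin: "finite ?T"
    using finite_dark_corners by simp
  have orb: "orbit tau h = {h, r (r h)}" if "h \<in> ?T" for h
  proof -
    have h: "h \<in> H" and t: "tau h = r (r h)" "tau (r (r h)) = h"
      using that by (auto simp: tau_def dark_corners_iff r_in opposite_dark crossing_r r4)
    have "k \<in> {h, r (r h)}" if "k \<in> orbit tau h" for k
      using that by induction (use t in auto)
    moreover have "{h, r (r h)} \<subseteq> orbit tau h"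
      using orbit.base[of tau h] orbit.step[of "r (r h)" tau h] t by simp
    ultimately show ?thesis
      by blast
  qed
  have "card (orbit tau h) = 2" if "h \<in> ?T" for h
    using orb[OF that] that r_r_neq[of h] by (auto simp: dark_corners_iff)
  then have "card ?T = 2 * card (orbit tau ` ?T)"
    by (rule card_orbits_uniform[OF tau_permutes fin])
  moreover have "card (orbit tau ` ?T) = card (crossing D ` ?T)"
  proof (rule card_image_eq_of_same_fibres)
    fix h k assume hk: "h \<in> ?T" "k \<in> ?T"
    then have H: "h \<in> H" "k \<in> H" "dark h" "dark k"
      by (auto simp: dark_corners_iff)
    \<comment> \<open>Of the four corners at the crossing only \<open>h\<close> and
      \<open>r (r h)\<close> are black.\<close>
    have "k \<in> orbit tau h \<longleftrightarrow> k \<in> crossing D h"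
      using H by (auto simp: orb[OF hk(1)] crossing_eq dark_r r_in)
    then show "orbit tau h = orbit tau k \<longleftrightarrow> crossing D h = crossing D k"
      by (simp add: orbit_eq_iff[OF permutation_tau] in_crossing_iff)
  qed
  moreover have "crossing D ` ?T = {c \<in> crossings D. to_black c}"
  proof -
    have "\<exists>k \<in> ?T. crossing D k = crossing D h" if "h \<in> H" "to_black (crossing D h)" for h
    proof (cases "dark h")
      case True
      then show ?thesis
        using that by (auto simp: dark_corners_iff)
    next
      case False
      \<comment> \<open>The neighbouring corner \<open>r h\<close> has the other colour, so it is a
        black corner of the same crossing.\<close>
      then show ?thesis
        using that by (intro bexI[of _ "r h"]) (auto simp: dark_corners_iff dark_r r_in crossing_r)
    qed
    then show ?thesis
      unfolding crossings_def dark_corners_def by blast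
  qed
  ultimately show ?thesis
    using evenperm_iff_card_orbits[OF fin tau_permutes] by simp
qed

text \<open>Every component is traced with the black side on its right, that is, along dark half-edges
  only.\<close>

definition entry :: "'h \<Rightarrow> 'h" where
  "entry h = (if dark h then h else f h)"

lemma entry_in: "h \<in> H \<Longrightarrow> entry h \<in> dark_corners"
  by (simp add: entry_def dark_corners_iff f_in dark_f)

text \<open>The branches are the two smoothings: after crossing the edge of \<open>h\<close>, the
  curve turns to the clockwise neighbour of \<open>f h\<close> (three counterclockwise turns) or to
  the counterclockwise one.\<close>

lemma trace_eq:
  assumes "h \<in> dark_corners"
  shows "trace h = (if to_black (crossing D (f h)) then r (r (r (f h))) else r (f h))"
  using assms
  by (auto simp: trace_def sigma_def tau_def dark_corners_iff r_in f_in region_rf crossing_r)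

text \<open>An edge does not change \<open>entry\<close>; an arc moves it by one step of
  \<open>trace\<close>, backwards from a dark \<open>h\<close> and forwards otherwise.\<close>

lemma orbit_entry_step:
  assumes "(h, k) \<in> Jordan_resolution D x"
  shows "orbit trace (entry h) = orbit trace (entry k)"
proof -
  have h: "h \<in> H" and "k = f h \<or> k = r h \<and> (dark h \<longleftrightarrow> to_black (crossing D h))"
    using assms by (auto simp: Jordan_resolution_iff)
  then consider "k = f h" | "k = r h" "dark h" "to_black (crossing D h)"
    | "k = r h" "\<not> dark h" "\<not> to_black (crossing D h)"
    by blast
  then show ?thesis
  proof cases
    case 1
    then show ?thesis
      using h by (simp add: entry_def dark_f f_f)
  next
    case 2
    then have "trace (entry k) = entry h"
      using h trace_eq[OF entry_in[of k]] by (simp add: entry_def dark_r r_in f_f crossing_r r4)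
    then show ?thesis
      using permutation_orbit_step[OF permutation_trace, of "entry k"] by simp
  next
    case 3
    then have "trace (entry h) = entry k"
      using h trace_eq[OF entry_in[of h]] by (simp add: entry_def dark_r r_in f_f)
    then show ?thesis
      using permutation_orbit_step[OF permutation_trace, of "entry h"] by simp
  qed
qed

section \<open>Components of the resolution as cycles of \<open>trace\<close>\<close>

abbreviation connected :: "('h \<times> 'h) set" where
  "connected \<equiv> (Jordan_resolution D x \<union> (Jordan_resolution D x)\<inverse>)\<^sup>*"

lemma connected_sym: "(h, k) \<in> connected \<Longrightarrow> (k, h) \<in> connected"
  by (metis converse_Un converse_converse rtrancl_converseI sup_commute)

lemma connected_imp_orbit_eq:
  "(h, k) \<in> connected \<Longrightarrow> orbit trace (entry h) = orbit trace (entry k)"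
  by (induction rule: rtrancl_induct) (auto dest: orbit_entry_step)

lemma connected_entry: "h \<in> H \<Longrightarrow> (h, entry h) \<in> connected"
  by (auto simp: entry_def Jordan_resolution_iff)

text \<open>A step of \<open>trace\<close> is the edge of \<open>h\<close> followed by one arc at
  the crossing of \<open>f h\<close>.\<close>

lemma connected_trace:
  assumes "h \<in> dark_corners"
  shows "(h, trace h) \<in> connected"
proof -
  have h: "h \<in> H" "dark h"
    using assms by (auto simp: dark_corners_iff)
  have "(h, f h) \<in> connected"
    using h by (auto simp: Jordan_resolution_iff)
  also have "(f h, trace h) \<in> connected"
  proof (cases "to_black (crossing D (f h))")
    case True
    \<comment> \<open>Arcs are recorded counterclockwise, so this clockwise turn is found as a link
      from \<open>trace h\<close> back to \<open>f h\<close>.\<close>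
    then have "(trace h, f h) \<in> Jordan_resolution D x"
      using h by (simp add: trace_eq[OF assms] Jordan_resolution_iff r_in f_in dark_r dark_f crossing_r r4)
    then show ?thesis
      by (simp add: r_into_rtrancl)
  next
    case False
    then have "(f h, trace h) \<in> Jordan_resolution D x"
      using h by (simp add: trace_eq[OF assms] Jordan_resolution_iff f_in dark_f)
    then show ?thesis
      by (simp add: r_into_rtrancl)
  qed
  finally show ?thesis .
qed

lemma connected_orbit:
  assumes "h \<in> dark_corners" "k \<in> orbit trace h"
  shows "(h, k) \<in> connected"
  using assms(2)
proof induction
  case base
  show ?case
    using connected_trace[OF assms(1)] .
next
  case (step k)
  have "k \<in> dark_corners"
    using step.hyps permutes_orbit_subset[OF trace_permutes assms(1)] by blast
  from step.IH connected_trace[OF this] show ?case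
    by (rule rtrancl_trans)
qed

lemma connected_iff:
  assumes "h \<in> H" "k \<in> H"
  shows "(h, k) \<in> connected \<longleftrightarrow> orbit trace (entry h) = orbit trace (entry k)"
proof
  assume "orbit trace (entry h) = orbit trace (entry k)"
  then have "(entry h, entry k) \<in> connected"
    using connected_orbit[OF entry_in[OF assms(1)]] by (simp add: orbit_eq_iff[OF permutation_trace])
  with connected_entry[OF assms(1)] have "(h, entry k) \<in> connected"
    by (rule rtrancl_trans)
  then show "(h, k) \<in> connected"
    using connected_sym[OF connected_entry[OF assms(2)]] by (rule rtrancl_trans)
qed (rule connected_imp_orbit_eq)

text \<open>By \<open>connected_iff\<close>, the component of a half-edge and the cycle of its
  \<open>entry\<close> have the same fibres on \<open>H\<close>; \<open>entry\<close> maps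
  \<open>H\<close> onto the black corners because it fixes each of them.\<close>

lemma card_Jordan_components: "card (Jordan_components D x) = card (orbit trace ` dark_corners)"
proof -
  have "Jordan_components D x = (\<lambda>h. connected `` {h}) ` H"
    by (auto simp: Jordan_components_def quotient_def)
  also have "card \<dots> = card ((\<lambda>h. orbit trace (entry h)) ` H)"
  proof (rule card_image_eq_of_same_fibres)
    fix h k assume hk: "h \<in> H" "k \<in> H"
    have "connected `` {h} = connected `` {k} \<longleftrightarrow> (h, k) \<in> connected"
    proof
      assume "connected `` {h} = connected `` {k}"
      then show "(h, k) \<in> connected"
        by blast
    next
      assume "(h, k) \<in> connected"
      then show "connected `` {h} = connected `` {k}"
        using connected_sym[of h k] rtrancl_trans[of h k] rtrancl_trans[of k h] by blast
    qed
    then show "connected `` {h} = connected `` {k} \<longleftrightarrow> orbit trace (entry h) = orbit trace (entry k)"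
      using connected_iff[OF hk] by simp
  qed
  also have "(\<lambda>h. orbit trace (entry h)) ` H = orbit trace ` dark_corners"
  proof -
    have "entry ` H = dark_corners"
    proof
      show "dark_corners \<subseteq> entry ` H"
        by (rule subsetI, rule image_eqI) (auto simp: entry_def dark_corners_iff)
    qed (use entry_in in blast)
    then show ?thesis
      by (simp flip: image_image)
  qed
  finally show ?thesis .
qed

text \<open>The sign is multiplicative on \<open>tau\<close> and \<open>sigma\<close>. As
  \<open>trace\<close> and \<open>sigma\<close> permute the same set, the size of
  \<open>dark_corners\<close> cancels and only the cycle counts remain.\<close>

lemma even_card_Jordan_components:
  "even (card (Jordan_components D x)) \<longleftrightarrow>
   even (card black + card {c \<in> crossings D. to_black c})"
proof -
  have "evenperm trace \<longleftrightarrow> evenperm tau = evenperm sigma"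
    unfolding trace_def by (rule evenperm_comp[OF permutation_tau permutation_sigma])
  then show ?thesis
    using evenperm_iff_card_orbits[OF finite_dark_corners trace_permutes]
      evenperm_iff_card_orbits[OF finite_dark_corners sigma_permutes]
    unfolding evenperm_tau card_Jordan_components orbits_sigma by (auto simp: even_add)
qed

section \<open>Matched and unmatched regions\<close>

lemma ran_x: "ran x = (the \<circ> x) ` crossings D"
  using dom_x by (force simp: ran_def dom_def)

lemma inj_the_x: "inj_on (the \<circ> x) (crossings D)"
  using inj_x dom_x by (intro inj_onI) (metis comp_apply domIff inj_onD option.expand)

lemma ran_subset: "ran x \<subseteq> regions D"
proof
  fix q assume "q \<in> ran x"
  then obtain c where c: "x c = Some q"
    by (auto simp: ran_def)
  then have "c \<in> crossings D" "q \<in> region D ` c"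
    using dom_x state by (auto simp: partial_Kauffman_states_def)
  then show "q \<in> regions D"
    using crossing_subset by (auto simp: crossings_def regions_def)
qed

text \<open>Injectivity gives as many matched regions as crossings, two fewer than there are
  regions.\<close>

lemma card_unmatched: "card (unmatched_regions D x) = 2"
proof -
  have "card (ran x) = card (crossings D)"
    unfolding ran_x by (rule card_image[OF inj_the_x])
  moreover have "card (unmatched_regions D x) = card (regions D) - card (ran x)"
    unfolding unmatched_regions_def
    by (rule card_Diff_subset) (use ran_subset finite_regions finite_subset in blast)+
  ultimately show ?thesis
    using card_regions by simp
qed

text \<open>The matching is a bijection from the crossings sent to black onto the matched black
  regions.\<close>

lemma card_unmatched_black:
  "card black = card (unmatched_regions D x \<inter> black) + card {c \<in> crossings D. to_black c}"
proof -
  have fin: "finite black"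
    using black_subset finite_regions finite_subset by blast
  have "ran x \<inter> black = (the \<circ> x) ` {c \<in> crossings D. to_black c}"
    by (auto simp: ran_x to_black_def)
  then have "card (ran x \<inter> black) = card {c \<in> crossings D. to_black c}"
    using card_image[OF inj_on_subset[OF inj_the_x]] by (metis (lifting) mem_Collect_eq subsetI)
  moreover have "black = (unmatched_regions D x \<inter> black) \<union> (ran x \<inter> black)"
    using black_subset by (auto simp: unmatched_regions_def)
  moreover have "card ((unmatched_regions D x \<inter> black) \<union> (ran x \<inter> black)) =
      card (unmatched_regions D x \<inter> black) + card (ran x \<inter> black)"
    by (rule card_Un_disjoint) (use fin in \<open>auto simp: unmatched_regions_def\<close>)
  ultimately show ?thesis
    by simp
qed

text \<open>The unmatched black and white counts add up to 2, so the black one is odd only when both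
  are 1.\<close>

lemma admissible_iff: "admissible D black x \<longleftrightarrow> odd (card (unmatched_regions D x \<inter> black))"
proof -
  have "finite (unmatched_regions D x)"
    by (simp add: unmatched_regions_def finite_regions)
  then have "card (unmatched_regions D x \<inter> black) + card (unmatched_regions D x - black) = 2"
    using card_unmatched card_Int_Diff by metis
  then show ?thesis
    using perfect by (cases "card (unmatched_regions D x \<inter> black) \<in> {0, 1, 2}")
      (auto simp: admissible_def)
qed

end

theorem proposition6p8:
  fixes D :: "'h projection" and black :: "'h set set" and x :: "'h matching"
  assumes "knot_projection D"
    and "reduced D"
    and "chequerboard_colouring D black"
    and "x \<in> partial_Kauffman_states D"
    and "perfect D x"
  shows "admissible D black x \<longleftrightarrow> odd (card (Jordan_components D x))"
proof -
  interpret perfect_matching D black x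
    by unfold_locales (use assms in \<open>auto simp: knot_projection_def\<close>)
  show ?thesis
    \<comment> \<open>Modulo 2, the crossings matched with black are counted twice and cancel,
      leaving the unmatched black regions.\<close>
    using admissible_iff even_card_Jordan_components card_unmatched_black by auto
qed

end
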